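(* Let $L_1$ and $L_2$ be disjoint finite lattices, let $a<b$ in $L_1$ with $b$ not covering $a$, and put $L=L_1]_a^bL_2$. Then: (a) If $a\neq 0$ and $a\notin V(G_{\{0\}}(L_1))$, then $G_{\{0\}}(L)=G_{\{0\}}(L_1)$. (b) If $a\in V(G_{\{0\}}(L_1))$, then $G_{\{0\}}(L)=G_{\{0\}}(L_1)\cup\big(G_a+N(L_2)\big)$, where $G_a=\{x\in L_1 : a,x \text{ are adjacent in } G_{\{0\}}(L_1)\}$ (regarded as a graph on this vertex set with no edges). (c) If $a=0$, then $G_{\{0\}}(L)=G_{\{0\}}(L_1)\cup\Big(N\big(L_1^*\setminus[b)\big)+N(L_2)\Big)$, where $[b)=\{x\in L_1 : x\ge b\}$ and $L_1^*=L_1\setminus\{0\}$.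
   Context: Adjunct operation: for disjoint finite lattices $L_1,L_2$ and $a<b$ in $L_1$ with $b$ not covering $a$, $L=L_1]_a^bL_2$ is the set $L_1\cup L_2$ ordered by: $x\le y$ iff ($x,y\in L_1$ and $x\le y$ in $L_1$) or ($x,y\in L_2$ and $x\le y$ in $L_2$) or ($x\in L_1$, $y\in L_2$, $x\le a$ in $L_1$) or ($x\in L_2$, $y\in L_1$, $b\le y$ in $L_1$); this is a lattice. The zero-divisor graph $G_{\{0\}}(L)$ of a lattice $L$ with least element $0$ has vertex set $V(G_{\{0\}}(L))=\{x\in L\setminus\{0\} : x\wedge y=0 \text{ for some } y\in L\setminus\{0\}\}$, distinct vertices $x,y$ adjacent iff $x\wedge y=0$. For graphs $G_1,G_2$: the union $G_1\cup G_2$ has vertex set $V(G_1)\cup V(G_2)$ and edge set $E(G_1)\cup E(G_2)$; the join $G_1+G_2$ has vertex set $V(G_1)\cup V(G_2)$ and edges $E(G_1)\cup E(G_2)\cup\{\{x_1,x_2\}: x_1\in V(G_1),x_2\in V(G_2)\}$. $N(S)$ denotes the null graph (no edges) on the set $S$. *)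

theory Defs
  imports "HOL-Algebra.Lattice"
begin

definition covers :: "('a, 'm) gorder_scheme \<Rightarrow> 'a \<Rightarrow> 'a \<Rightarrow> bool"
  where "covers L b a \<longleftrightarrow>
    a \<in> carrier L \<and> b \<in> carrier L \<and> a \<sqsubset>\<^bsub>L\<^esub> b \<and>
    \<not> (\<exists>c\<in>carrier L. a \<sqsubset>\<^bsub>L\<^esub> c \<and> c \<sqsubset>\<^bsub>L\<^esub> b)"

text \<open>\<open>adjunct L1 a b L2\<close> is the adjunct written \<open>L1 ]\<^sub>a\<^sup>b L2\<close>.\<close>

definition adjunct :: "'a gorder \<Rightarrow> 'a \<Rightarrow> 'a \<Rightarrow> 'a gorder \<Rightarrow> 'a gorder"
  where "adjunct L1 a b L2 =
    \<lparr> carrier = carrier L1 \<union> carrier L2,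
      eq = (=),
      le = (\<lambda>x y.
        x \<in> carrier L1 \<and> y \<in> carrier L1 \<and> x \<sqsubseteq>\<^bsub>L1\<^esub> y \<or>
        x \<in> carrier L2 \<and> y \<in> carrier L2 \<and> x \<sqsubseteq>\<^bsub>L2\<^esub> y \<or>
        x \<in> carrier L1 \<and> y \<in> carrier L2 \<and> x \<sqsubseteq>\<^bsub>L1\<^esub> a \<or>
        x \<in> carrier L2 \<and> y \<in> carrier L1 \<and> b \<sqsubseteq>\<^bsub>L1\<^esub> y) \<rparr>"

record 'a ugraph =
  vertices :: "'a set"
  edges :: "'a set set"

definition graph_union :: "'a ugraph \<Rightarrow> 'a ugraph \<Rightarrow> 'a ugraph"
  where "graph_union G H =
    \<lparr> vertices = vertices G \<union> vertices H, edges = edges G \<union> edges H \<rparr>"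

definition graph_join :: "'a ugraph \<Rightarrow> 'a ugraph \<Rightarrow> 'a ugraph"
  where "graph_join G H =
    \<lparr> vertices = vertices G \<union> vertices H,
      edges = edges G \<union> edges H \<union> {{x, y} | x y. x \<in> vertices G \<and> y \<in> vertices H} \<rparr>"

definition null_graph :: "'a set \<Rightarrow> 'a ugraph"
  where "null_graph S = \<lparr> vertices = S, edges = {} \<rparr>"

definition adjacent :: "'a ugraph \<Rightarrow> 'a \<Rightarrow> 'a \<Rightarrow> bool"
  where "adjacent G x y \<longleftrightarrow> {x, y} \<in> edges G"

definition zd_vertices :: "('a, 'm) gorder_scheme \<Rightarrow> 'a set"
  where "zd_vertices L =
    {x \<in> carrier L - {\<bottom>\<^bsub>L\<^esub>}. \<exists>y \<in> carrier L - {\<bottom>\<^bsub>L\<^esub>}. x \<sqinter>\<^bsub>L\<^esub> y = \<bottom>\<^bsub>L\<^esub>}"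

definition zero_divisor_graph :: "('a, 'm) gorder_scheme \<Rightarrow> 'a ugraph"
  where "zero_divisor_graph L =
    \<lparr> vertices = zd_vertices L,
      edges = {{x, y} | x y. x \<in> zd_vertices L \<and> y \<in> zd_vertices L \<and> x \<noteq> y \<and>
                             x \<sqinter>\<^bsub>L\<^esub> y = \<bottom>\<^bsub>L\<^esub>} \<rparr>"

end

theory Submission
  imports Defs
begin

text \<open>
  The meet of \<open>L\<^sub>1\<close> extends to the adjunct: it is unchanged inside \<open>L\<^sub>1\<close> and inside \<open>L\<^sub>2\<close>, and for
  \<open>x \<in> L\<^sub>1\<close>, \<open>y \<in> L\<^sub>2\<close> it is \<open>y\<close> when \<open>b \<le> x\<close> and \<open>x \<and> a\<close> otherwise. Since the least element
  of the adjunct is that of \<open>L\<^sub>1\<close>, the only new edges are those \<open>{x, y}\<close> with \<open>x \<in> L\<^sub>1\<close> nonzero,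
  \<open>y \<in> L\<^sub>2\<close>, \<open>x \<and> a = 0\<close> and \<open>b \<nleq> x\<close>. The set of such \<open>x\<close> is empty in case (a), the
  neighbourhood of \<open>a\<close> in case (b), and \<open>L\<^sub>1\<^sup>* - [b)\<close> in case (c).
\<close>

section \<open>Recognising least elements and binary meets\<close>

lemma (in partial_order) bottomI:
  assumes "z \<in> carrier L" and "\<And>x. x \<in> carrier L \<Longrightarrow> z \<sqsubseteq> x"
  shows "\<bottom> = z"
proof -
  have z: "least L z (carrier L)"
    using assms by (auto simp: least_def)
  then have "least L \<bottom> (carrier L)"
    unfolding bottom_def by (rule someI)
  then show ?thesis
    using z least_unique by blast
qed

text \<open>Meets are choice terms, so uniqueness of greatest elements pins them down. Only a
  partial order is assumed, so meets in the adjunct can be computed without first showing that it is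
  a lattice.\<close>

lemma (in partial_order) meet_eqI:
  assumes xy: "x \<in> carrier L" "y \<in> carrier L"
    and m: "m \<in> carrier L" "m \<sqsubseteq> x" "m \<sqsubseteq> y"
    and glb: "\<And>z. \<lbrakk>z \<in> carrier L; z \<sqsubseteq> x; z \<sqsubseteq> y\<rbrakk> \<Longrightarrow> z \<sqsubseteq> m"
  shows "x \<sqinter> y = m"
proof -
  have g: "greatest L m (Lower L {x, y})"
    using assms by (auto simp: greatest_def Lower_def)
  then have "greatest L (x \<sqinter> y) (Lower L {x, y})"
    unfolding meet_def inf_def by (rule someI)
  then show ?thesis
    using g greatest_unique by blast
qed

text \<open>Finiteness makes the infimum of the whole carrier available, and that infimum is a least
  element.\<close>

lemma (in lower_semilattice) finite_bottom:
  assumes "finite (carrier L)" and "carrier L \<noteq> {}"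
  shows "\<bottom> \<in> carrier L" and "\<And>x. x \<in> carrier L \<Longrightarrow> \<bottom> \<sqsubseteq> x"
proof -
  have g: "greatest L (\<Sqinter>carrier L) (Lower L (carrier L))"
    using assms by (intro finite_inf_greatest) auto
  then have "\<Sqinter>carrier L \<in> carrier L" and "\<And>x. x \<in> carrier L \<Longrightarrow> \<Sqinter>carrier L \<sqsubseteq> x"
    by (auto simp: greatest_def Lower_def)
  moreover from this have "\<bottom> = \<Sqinter>carrier L"
    by (rule bottomI)
  ultimately show "\<bottom> \<in> carrier L" and "\<And>x. x \<in> carrier L \<Longrightarrow> \<bottom> \<sqsubseteq> x"
    by simp_all
qed

lemma vertices_zero_divisor_graph: "vertices (zero_divisor_graph L) = zd_vertices L"
  by (simp add: zero_divisor_graph_def)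

text \<open>Two nonzero elements with meet zero witness each other's membership in
  \<open>zd_vertices\<close>, so edges can be studied through nonzero elements alone.\<close>

lemma edges_zero_divisor_graph:
  "edges (zero_divisor_graph L) =
    {{x, y} | x y. x \<in> carrier L - {\<bottom>\<^bsub>L\<^esub>} \<and> y \<in> carrier L - {\<bottom>\<^bsub>L\<^esub>} \<and> x \<noteq> y \<and>
                   x \<sqinter>\<^bsub>L\<^esub> y = \<bottom>\<^bsub>L\<^esub>}"
proof -
  have "x \<in> zd_vertices L \<and> y \<in> zd_vertices L \<and> x \<noteq> y \<and> x \<sqinter>\<^bsub>L\<^esub> y = \<bottom>\<^bsub>L\<^esub> \<longleftrightarrow>
      x \<in> carrier L - {\<bottom>\<^bsub>L\<^esub>} \<and> y \<in> carrier L - {\<bottom>\<^bsub>L\<^esub>} \<and> x \<noteq> y \<and> x \<sqinter>\<^bsub>L\<^esub> y = \<bottom>\<^bsub>L\<^esub>" for x y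
    using meet_comm[of L x y] unfolding zd_vertices_def by auto
  then show ?thesis
    by (simp only: zero_divisor_graph_def ugraph.simps)
qed

section \<open>The adjunct as a partial order\<close>

locale adjunct_pair = L1: lattice L1 + L2: lattice L2
  for L1 L2 :: "'a gorder" +
  fixes a b :: 'a
  assumes finite1: "finite (carrier L1)"
    and nonempty2: "carrier L2 \<noteq> {}"
    and disjoint: "carrier L1 \<inter> carrier L2 = {}"
    and a_in: "a \<in> carrier L1" and b_in: "b \<in> carrier L1"
    and a_less_b: "a \<sqsubset>\<^bsub>L1\<^esub> b"
begin

abbreviation L :: "'a gorder"
  where "L \<equiv> adjunct L1 a b L2"

lemma carrier_adjunct: "carrier L = carrier L1 \<union> carrier L2"
  by (simp add: adjunct_def)

lemma le_a_b: "a \<sqsubseteq>\<^bsub>L1\<^esub> b" and a_neq_b: "a \<noteq> b"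
  using a_less_b by (auto simp: lless_def L1.eq_is_equal)

lemma not_b_le_a: "\<not> b \<sqsubseteq>\<^bsub>L1\<^esub> a"
  using L1.le_antisym a_in a_neq_b b_in le_a_b by blast

lemma in_one_side: "x \<in> carrier L1 \<Longrightarrow> x \<notin> carrier L2" "x \<in> carrier L2 \<Longrightarrow> x \<notin> carrier L1"
  using disjoint by auto

lemma adjunct_le:
  "\<lbrakk>x \<in> carrier L1; y \<in> carrier L1\<rbrakk> \<Longrightarrow> x \<sqsubseteq>\<^bsub>L\<^esub> y \<longleftrightarrow> x \<sqsubseteq>\<^bsub>L1\<^esub> y"
  "\<lbrakk>x \<in> carrier L2; y \<in> carrier L2\<rbrakk> \<Longrightarrow> x \<sqsubseteq>\<^bsub>L\<^esub> y \<longleftrightarrow> x \<sqsubseteq>\<^bsub>L2\<^esub> y"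
  "\<lbrakk>x \<in> carrier L1; y \<in> carrier L2\<rbrakk> \<Longrightarrow> x \<sqsubseteq>\<^bsub>L\<^esub> y \<longleftrightarrow> x \<sqsubseteq>\<^bsub>L1\<^esub> a"
  "\<lbrakk>x \<in> carrier L2; y \<in> carrier L1\<rbrakk> \<Longrightarrow> x \<sqsubseteq>\<^bsub>L\<^esub> y \<longleftrightarrow> b \<sqsubseteq>\<^bsub>L1\<^esub> y"
  using in_one_side by (auto simp: adjunct_def)

sublocale adj: partial_order L
proof
  show eq: "(.=\<^bsub>L\<^esub>) = (=)"
    by (simp add: adjunct_def)
  show "x .=\<^bsub>L\<^esub> x" for x
    by (simp add: eq)
  show "y .=\<^bsub>L\<^esub> x" if "x .=\<^bsub>L\<^esub> y" for x y
    using that by (simp add: eq)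
  show "x .=\<^bsub>L\<^esub> z" if "x .=\<^bsub>L\<^esub> y" "y .=\<^bsub>L\<^esub> z" for x y z
    using that by (simp add: eq)
  show "x \<sqsubseteq>\<^bsub>L\<^esub> x" if "x \<in> carrier L" for x
    using that by (auto simp: carrier_adjunct adjunct_le)
  show "x \<sqsubseteq>\<^bsub>L\<^esub> z \<longleftrightarrow> y \<sqsubseteq>\<^bsub>L\<^esub> w" if "x .=\<^bsub>L\<^esub> y" "z .=\<^bsub>L\<^esub> w" for x y z w
    using that by (simp add: eq)
  \<comment> \<open>Such an \<open>x\<close> would give \<open>b\<close> below \<open>a\<close>.
    This settles antisymmetry for mixed pairs and excludes chains from \<open>L2\<close> through
    \<open>L1\<close> back to \<open>L2\<close>; chains from \<open>L1\<close> through
    \<open>L2\<close> back to \<open>L1\<close> compose because \<open>a\<close> is below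
    \<open>b\<close>.\<close>
  have no_cycle: False
    if "x \<in> carrier L1" "x \<sqsubseteq>\<^bsub>L1\<^esub> a" "b \<sqsubseteq>\<^bsub>L1\<^esub> x" for x
    using that L1.le_trans a_in b_in not_b_le_a by blast
  show "x .=\<^bsub>L\<^esub> y"
    if "x \<sqsubseteq>\<^bsub>L\<^esub> y" "y \<sqsubseteq>\<^bsub>L\<^esub> x" "x \<in> carrier L" "y \<in> carrier L" for x y
    using that no_cycle unfolding carrier_adjunct eq
    by (elim UnE) (auto simp: adjunct_le)
  show "x \<sqsubseteq>\<^bsub>L\<^esub> z"
    if xyz: "x \<sqsubseteq>\<^bsub>L\<^esub> y" "y \<sqsubseteq>\<^bsub>L\<^esub> z" "x \<in> carrier L" "y \<in> carrier L" "z \<in> carrier L" for x y z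
    using xyz a_in b_in le_a_b no_cycle unfolding carrier_adjunct
    by (elim UnE; simp add: adjunct_le) (blast intro: L1.le_trans L2.le_trans)+
qed

section \<open>Least element and meets of the adjunct\<close>

lemma bottom1: "\<bottom>\<^bsub>L1\<^esub> \<in> carrier L1" "x \<in> carrier L1 \<Longrightarrow> \<bottom>\<^bsub>L1\<^esub> \<sqsubseteq>\<^bsub>L1\<^esub> x"
  using L1.finite_bottom finite1 a_in by auto

lemma bottom_adjunct: "\<bottom>\<^bsub>L\<^esub> = \<bottom>\<^bsub>L1\<^esub>"
  by (rule adj.bottomI) (auto simp: carrier_adjunct bottom1 adjunct_le a_in)

text \<open>A common lower bound from \<open>L2\<close> forces \<open>b\<close> below both
  \<open>x\<close> and \<open>y\<close>, hence below their meet in \<open>L1\<close>, so it lies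
  below that meet in the adjunct.\<close>

lemma meet_adjunct_11:
  assumes "x \<in> carrier L1" "y \<in> carrier L1"
  shows "x \<sqinter>\<^bsub>L\<^esub> y = x \<sqinter>\<^bsub>L1\<^esub> y"
  using assms b_in
  by (intro adj.meet_eqI)
    (auto simp: carrier_adjunct adjunct_le intro: L1.meet_left L1.meet_right L1.meet_le)

text \<open>A common lower bound from \<open>L1\<close> lies below \<open>a\<close>, hence below
  every element of \<open>L2\<close>.\<close>

lemma meet_adjunct_22:
  assumes "x \<in> carrier L2" "y \<in> carrier L2"
  shows "x \<sqinter>\<^bsub>L\<^esub> y = x \<sqinter>\<^bsub>L2\<^esub> y"
  using assms
  by (intro adj.meet_eqI)
    (auto simp: carrier_adjunct adjunct_le intro: L2.meet_left L2.meet_right L2.meet_le)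

text \<open>If \<open>b\<close> is below \<open>x\<close>, then all of \<open>L2\<close> is below
  \<open>x\<close>. Otherwise no lower bound of \<open>x\<close> comes from \<open>L2\<close>, and
  the common lower bounds are the elements of \<open>L1\<close> below both \<open>x\<close> and
  \<open>a\<close>.\<close>

lemma meet_adjunct_12:
  assumes "x \<in> carrier L1" "y \<in> carrier L2"
  shows "x \<sqinter>\<^bsub>L\<^esub> y = (if b \<sqsubseteq>\<^bsub>L1\<^esub> x then y else x \<sqinter>\<^bsub>L1\<^esub> a)"
proof (cases "b \<sqsubseteq>\<^bsub>L1\<^esub> x")
  case True
  then show ?thesis
    using assms by (auto simp: carrier_adjunct adjunct_le intro!: adj.meet_eqI)
next
  case False
  have "x \<sqinter>\<^bsub>L\<^esub> y = x \<sqinter>\<^bsub>L1\<^esub> a"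
    using assms a_in False
    by (intro adj.meet_eqI)
      (auto simp: carrier_adjunct adjunct_le intro: L1.meet_left L1.meet_right L1.meet_le)
  with False show ?thesis
    by simp
qed

section \<open>The zero-divisor graph of the adjunct\<close>

text \<open>These are the nonzero elements of \<open>L1\<close> whose meet with an element of
  \<open>L2\<close> is zero. The condition does not depend on the element of \<open>L2\<close>,
  which is why a full join appears.\<close>

definition cross :: "'a set"
  where "cross = {x \<in> carrier L1 - {\<bottom>\<^bsub>L1\<^esub>}. \<not> b \<sqsubseteq>\<^bsub>L1\<^esub> x \<and> x \<sqinter>\<^bsub>L1\<^esub> a = \<bottom>\<^bsub>L1\<^esub>}"

lemma meet_adjunct_bottom_iff:
  "\<lbrakk>x \<in> carrier L1; y \<in> carrier L1\<rbrakk> \<Longrightarrow> x \<sqinter>\<^bsub>L\<^esub> y = \<bottom>\<^bsub>L1\<^esub> \<longleftrightarrow> x \<sqinter>\<^bsub>L1\<^esub> y = \<bottom>\<^bsub>L1\<^esub>"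
  "\<lbrakk>x \<in> carrier L2; y \<in> carrier L2\<rbrakk> \<Longrightarrow> x \<sqinter>\<^bsub>L\<^esub> y \<noteq> \<bottom>\<^bsub>L1\<^esub>"
  "\<lbrakk>x \<in> carrier L1 - {\<bottom>\<^bsub>L1\<^esub>}; y \<in> carrier L2\<rbrakk> \<Longrightarrow> x \<sqinter>\<^bsub>L\<^esub> y = \<bottom>\<^bsub>L1\<^esub> \<longleftrightarrow> x \<in> cross"
  "\<lbrakk>x \<in> carrier L2; y \<in> carrier L1 - {\<bottom>\<^bsub>L1\<^esub>}\<rbrakk> \<Longrightarrow> x \<sqinter>\<^bsub>L\<^esub> y = \<bottom>\<^bsub>L1\<^esub> \<longleftrightarrow> y \<in> cross"
proof -
  show 12: "x \<sqinter>\<^bsub>L\<^esub> y = \<bottom>\<^bsub>L1\<^esub> \<longleftrightarrow> x \<in> cross"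
    if "x \<in> carrier L1 - {\<bottom>\<^bsub>L1\<^esub>}" "y \<in> carrier L2" for x y
    using that bottom1(1) in_one_side by (auto simp: meet_adjunct_12 cross_def)
  show "x \<sqinter>\<^bsub>L\<^esub> y = \<bottom>\<^bsub>L1\<^esub> \<longleftrightarrow> y \<in> cross"
    if "x \<in> carrier L2" "y \<in> carrier L1 - {\<bottom>\<^bsub>L1\<^esub>}"
    using 12[OF that(2,1)] by (simp add: meet_comm)
  show "x \<sqinter>\<^bsub>L\<^esub> y \<noteq> \<bottom>\<^bsub>L1\<^esub>" if "x \<in> carrier L2" "y \<in> carrier L2"
    using that bottom1(1) in_one_side L2.meet_closed by (metis meet_adjunct_22)
qed (simp add: meet_adjunct_11)

lemma nonzero_carrier_adjunct:
  "carrier L - {\<bottom>\<^bsub>L1\<^esub>} = (carrier L1 - {\<bottom>\<^bsub>L1\<^esub>}) \<union> carrier L2"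
  using bottom1(1) in_one_side by (auto simp: carrier_adjunct)

lemma cross_subset: "cross \<subseteq> carrier L1 - {\<bottom>\<^bsub>L1\<^esub>}"
  by (auto simp: cross_def)

text \<open>Elements of \<open>L2\<close> never annihilate each other, so their partners lie in
  \<open>cross\<close>: either all of \<open>L2\<close> or none of it becomes vertices.\<close>

lemma zd_vertices_adjunct:
  "zd_vertices L = zd_vertices L1 \<union> cross \<union> (if cross = {} then {} else carrier L2)"
proof -
  let ?V = "(carrier L1 - {\<bottom>\<^bsub>L1\<^esub>}) \<union> carrier L2"
  have vertices_L: "zd_vertices L = {x \<in> ?V. \<exists>y \<in> ?V. x \<sqinter>\<^bsub>L\<^esub> y = \<bottom>\<^bsub>L1\<^esub>}"
    unfolding zd_vertices_def nonzero_carrier_adjunct bottom_adjunct ..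
  have iff: "(\<exists>y \<in> ?V. x \<sqinter>\<^bsub>L\<^esub> y = \<bottom>\<^bsub>L1\<^esub>) \<longleftrightarrow>
      (\<exists>y \<in> carrier L1 - {\<bottom>\<^bsub>L1\<^esub>}. x \<sqinter>\<^bsub>L1\<^esub> y = \<bottom>\<^bsub>L1\<^esub>) \<or> x \<in> cross"
    if x: "x \<in> carrier L1 - {\<bottom>\<^bsub>L1\<^esub>}" for x
  proof -
    have "(\<exists>y \<in> carrier L1 - {\<bottom>\<^bsub>L1\<^esub>}. x \<sqinter>\<^bsub>L\<^esub> y = \<bottom>\<^bsub>L1\<^esub>) \<longleftrightarrow>
        (\<exists>y \<in> carrier L1 - {\<bottom>\<^bsub>L1\<^esub>}. x \<sqinter>\<^bsub>L1\<^esub> y = \<bottom>\<^bsub>L1\<^esub>)"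
      using x by (intro bex_cong refl meet_adjunct_bottom_iff(1)) auto
    \<comment> \<open>Nonemptiness of \<open>L2\<close> supplies a partner for each \<open>x\<close>
      in \<open>cross\<close>.\<close>
    moreover have "(\<exists>y \<in> carrier L2. x \<sqinter>\<^bsub>L\<^esub> y = \<bottom>\<^bsub>L1\<^esub>) \<longleftrightarrow> x \<in> cross"
      using x nonempty2 meet_adjunct_bottom_iff(3) by blast
    ultimately show ?thesis
      by (simp only: bex_Un)
  qed
  have "zd_vertices L \<inter> (carrier L1 - {\<bottom>\<^bsub>L1\<^esub>}) =
      {x \<in> carrier L1 - {\<bottom>\<^bsub>L1\<^esub>}. \<exists>y \<in> ?V. x \<sqinter>\<^bsub>L\<^esub> y = \<bottom>\<^bsub>L1\<^esub>}"
    unfolding vertices_L by blast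
  also have "\<dots> = {x \<in> carrier L1 - {\<bottom>\<^bsub>L1\<^esub>}.
      (\<exists>y \<in> carrier L1 - {\<bottom>\<^bsub>L1\<^esub>}. x \<sqinter>\<^bsub>L1\<^esub> y = \<bottom>\<^bsub>L1\<^esub>) \<or> x \<in> cross}"
    by (simp only: iff cong: conj_cong)
  also have "\<dots> = zd_vertices L1 \<union> cross"
    using cross_subset unfolding zd_vertices_def by blast
  finally have part1: "zd_vertices L \<inter> (carrier L1 - {\<bottom>\<^bsub>L1\<^esub>}) = zd_vertices L1 \<union> cross" .
  have part2: "zd_vertices L \<inter> carrier L2 = (if cross = {} then {} else carrier L2)"
  proof -
    have "x \<in> zd_vertices L \<longleftrightarrow> cross \<noteq> {}" if x: "x \<in> carrier L2" for x
    proof -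
      have "x \<in> zd_vertices L \<longleftrightarrow> (\<exists>y \<in> ?V. x \<sqinter>\<^bsub>L\<^esub> y = \<bottom>\<^bsub>L1\<^esub>)"
        unfolding vertices_L using x by blast
      also have "\<dots> \<longleftrightarrow> (\<exists>y \<in> carrier L1 - {\<bottom>\<^bsub>L1\<^esub>}. x \<sqinter>\<^bsub>L\<^esub> y = \<bottom>\<^bsub>L1\<^esub>)"
        using meet_adjunct_bottom_iff(2)[OF x] by blast
      also have "\<dots> \<longleftrightarrow> (\<exists>y \<in> carrier L1 - {\<bottom>\<^bsub>L1\<^esub>}. y \<in> cross)"
        using meet_adjunct_bottom_iff(4)[OF x] by (rule bex_cong[OF refl])
      also have "\<dots> \<longleftrightarrow> cross \<noteq> {}"
        using cross_subset by blast
      finally show ?thesis .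
    qed
    then show ?thesis
      by (cases "cross = {}") auto
  qed
  have "zd_vertices L =
      zd_vertices L \<inter> (carrier L1 - {\<bottom>\<^bsub>L1\<^esub>}) \<union> zd_vertices L \<inter> carrier L2"
    unfolding vertices_L by blast
  also have "\<dots> = zd_vertices L1 \<union> cross \<union> (if cross = {} then {} else carrier L2)"
    by (simp only: part1 part2)
  finally show ?thesis .
qed

lemma edges_adjunct:
  "edges (zero_divisor_graph L) =
    edges (zero_divisor_graph L1) \<union> {{x, y} | x y. x \<in> cross \<and> y \<in> carrier L2}"
  (is "?E = ?E1 \<union> ?C")
proof
  show "?E \<subseteq> ?E1 \<union> ?C"
  proof
    fix e assume "e \<in> ?E"
    then obtain x y where e: "e = {x, y}" and ne: "x \<noteq> y" and xy: "x \<sqinter>\<^bsub>L\<^esub> y = \<bottom>\<^bsub>L1\<^esub>"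
      and side: "x \<in> (carrier L1 - {\<bottom>\<^bsub>L1\<^esub>}) \<union> carrier L2" "y \<in> (carrier L1 - {\<bottom>\<^bsub>L1\<^esub>}) \<union> carrier L2"
      unfolding edges_zero_divisor_graph nonzero_carrier_adjunct bottom_adjunct by blast
    consider (11) "x \<in> carrier L1 - {\<bottom>\<^bsub>L1\<^esub>}" "y \<in> carrier L1 - {\<bottom>\<^bsub>L1\<^esub>}"
      | (12) "x \<in> carrier L1 - {\<bottom>\<^bsub>L1\<^esub>}" "y \<in> carrier L2"
      | (21) "x \<in> carrier L2" "y \<in> carrier L1 - {\<bottom>\<^bsub>L1\<^esub>}"
      | (22) "x \<in> carrier L2" "y \<in> carrier L2"
      using side by blast
    then show "e \<in> ?E1 \<union> ?C"
    proof cases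
      case 11
      then have "x \<sqinter>\<^bsub>L1\<^esub> y = \<bottom>\<^bsub>L1\<^esub>"
        using xy meet_adjunct_bottom_iff(1) by blast
      then show ?thesis
        unfolding edges_zero_divisor_graph using 11 e ne by blast
    next
      case 12
      then show ?thesis
        using xy e meet_adjunct_bottom_iff(3) by blast
    next
      case 21
      then have "y \<in> cross"
        using xy meet_adjunct_bottom_iff(4) by blast
      then show ?thesis
        using 21 e by (auto simp: insert_commute)
    next
      case 22
      then show ?thesis
        using xy meet_adjunct_bottom_iff(2) by blast
    qed
  qed
  show "?E1 \<union> ?C \<subseteq> ?E"
  proof (intro Un_least subsetI)
    fix e assume "e \<in> ?E1"
    then show "e \<in> ?E"
      unfolding edges_zero_divisor_graph nonzero_carrier_adjunct bottom_adjunct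
      using meet_adjunct_bottom_iff(1) by blast
  next
    fix e assume "e \<in> ?C"
    then obtain x y where e: "e = {x, y}" and x: "x \<in> cross" and y: "y \<in> carrier L2"
      by blast
    then have "x \<in> carrier L1 - {\<bottom>\<^bsub>L1\<^esub>}" and "x \<noteq> y"
      using cross_subset in_one_side by blast+
    moreover from this have "x \<sqinter>\<^bsub>L\<^esub> y = \<bottom>\<^bsub>L1\<^esub>"
      using x y meet_adjunct_bottom_iff(3) by blast
    ultimately show "e \<in> ?E"
      unfolding edges_zero_divisor_graph nonzero_carrier_adjunct bottom_adjunct
      using e y by blast
  qed
qed

text \<open>The case split matters for vertices: a join with the empty null graph would still
  contribute all of \<open>L2\<close> as isolated vertices.\<close>

theorem zero_divisor_graph_adjunct:
  "zero_divisor_graph L =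
    (if cross = {} then zero_divisor_graph L1
     else graph_union (zero_divisor_graph L1)
       (graph_join (null_graph cross) (null_graph (carrier L2))))"
  by (rule ugraph.equality)
    (auto simp: edges_adjunct zd_vertices_adjunct graph_union_def graph_join_def null_graph_def
      vertices_zero_divisor_graph)

section \<open>The set \<open>cross\<close> for nonzero and for zero \<open>a\<close>\<close>

text \<open>For nonzero \<open>a\<close>, annihilating \<open>a\<close> already excludes the
  elements above \<open>b\<close>: they are above \<open>a\<close>, so their meet with
  \<open>a\<close> is \<open>a\<close> itself.\<close>

lemma cross_eq_annihilator:
  assumes "a \<noteq> \<bottom>\<^bsub>L1\<^esub>"
  shows "cross = {x \<in> carrier L1 - {\<bottom>\<^bsub>L1\<^esub>}. a \<sqinter>\<^bsub>L1\<^esub> x = \<bottom>\<^bsub>L1\<^esub>}"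
proof -
  have "x \<sqinter>\<^bsub>L1\<^esub> a = a" if "x \<in> carrier L1" "b \<sqsubseteq>\<^bsub>L1\<^esub> x" for x
  proof -
    have "a \<sqsubseteq>\<^bsub>L1\<^esub> x"
      using that L1.le_trans a_in b_in le_a_b by blast
    then show ?thesis
      using that a_in by (intro L1.meet_eqI) auto
  qed
  then show ?thesis
    using assms by (auto simp: cross_def meet_comm[of L1 a])
qed

lemma cross_eq_neighbours:
  assumes "a \<noteq> \<bottom>\<^bsub>L1\<^esub>"
  shows "cross = {x \<in> carrier L1. adjacent (zero_divisor_graph L1) a x}"
proof -
  \<comment> \<open>Idempotence shows that a nonzero \<open>a\<close> does not annihilate itself,
    which gives the distinct endpoints an edge requires.\<close>
  have "a \<sqinter>\<^bsub>L1\<^esub> a = a"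
    using a_in by (intro L1.meet_eqI) auto
  then have "a \<noteq> x" if "a \<sqinter>\<^bsub>L1\<^esub> x = \<bottom>\<^bsub>L1\<^esub>" for x
    using that assms by auto
  then have "{a, x} \<in> edges (zero_divisor_graph L1)"
    if "x \<in> carrier L1 - {\<bottom>\<^bsub>L1\<^esub>}" "a \<sqinter>\<^bsub>L1\<^esub> x = \<bottom>\<^bsub>L1\<^esub>" for x
    using that assms a_in unfolding edges_zero_divisor_graph by blast
  moreover have "x \<in> carrier L1 - {\<bottom>\<^bsub>L1\<^esub>} \<and> a \<sqinter>\<^bsub>L1\<^esub> x = \<bottom>\<^bsub>L1\<^esub>"
    if "{a, x} \<in> edges (zero_divisor_graph L1)" for x
    using that meet_comm[of L1 x a]
    by (auto simp: edges_zero_divisor_graph doubleton_eq_iff)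
  ultimately show ?thesis
    unfolding cross_eq_annihilator[OF assms] adjacent_def by blast
qed

lemma cross_eq_zero_a:
  assumes "a = \<bottom>\<^bsub>L1\<^esub>"
  shows "cross = (carrier L1 - {\<bottom>\<^bsub>L1\<^esub>}) - {x \<in> carrier L1. b \<sqsubseteq>\<^bsub>L1\<^esub> x}"
proof -
  have "x \<sqinter>\<^bsub>L1\<^esub> a = \<bottom>\<^bsub>L1\<^esub>" if "x \<in> carrier L1" for x
    using that bottom1 assms by (intro L1.meet_eqI) auto
  then show ?thesis
    by (auto simp: cross_def)
qed

text \<open>The non-covering hypothesis enters here: an element strictly between zero and
  \<open>b\<close> belongs to \<open>cross\<close>.\<close>

lemma cross_nonempty_if_not_covers:
  assumes "a = \<bottom>\<^bsub>L1\<^esub>" and "\<not> covers L1 b a"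
  shows "cross \<noteq> {}"
proof -
  obtain c where c: "c \<in> carrier L1" "a \<sqsubset>\<^bsub>L1\<^esub> c" "c \<sqsubset>\<^bsub>L1\<^esub> b"
    using assms(2) a_in b_in a_less_b by (auto simp: covers_def)
  then have "c \<noteq> \<bottom>\<^bsub>L1\<^esub>" "\<not> b \<sqsubseteq>\<^bsub>L1\<^esub> c"
    using assms(1) b_in by (auto simp: lless_def L1.eq_is_equal)
  then show ?thesis
    using c(1) cross_eq_zero_a[OF assms(1)] by blast
qed

text \<open>For nonzero \<open>a\<close>, this turns the case split on \<open>cross\<close> into the
  distinction between (a) and (b).\<close>

lemma cross_nonempty_iff:
  assumes "a \<noteq> \<bottom>\<^bsub>L1\<^esub>"
  shows "cross \<noteq> {} \<longleftrightarrow> a \<in> vertices (zero_divisor_graph L1)"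
  using assms a_in unfolding cross_eq_annihilator[OF assms]
  by (auto simp: vertices_zero_divisor_graph zd_vertices_def)

end

theorem theorem2p3:
  fixes L1 L2 L :: "'a gorder" and a b :: 'a
  assumes "lattice L1" and "finite (carrier L1)"
    and "lattice L2" and "finite (carrier L2)" and "carrier L2 \<noteq> {}"
    and "carrier L1 \<inter> carrier L2 = {}"
    and "a \<in> carrier L1" and "b \<in> carrier L1"
    and "a \<sqsubset>\<^bsub>L1\<^esub> b" and "\<not> covers L1 b a"
    and "L = adjunct L1 a b L2"
  shows "(a \<noteq> \<bottom>\<^bsub>L1\<^esub> \<and> a \<notin> vertices (zero_divisor_graph L1) \<longrightarrow>
            zero_divisor_graph L = zero_divisor_graph L1)
       \<and> (a \<in> vertices (zero_divisor_graph L1) \<longrightarrow>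
            zero_divisor_graph L =
              graph_union (zero_divisor_graph L1)
                (graph_join (null_graph {x \<in> carrier L1. adjacent (zero_divisor_graph L1) a x})
                            (null_graph (carrier L2))))
       \<and> (a = \<bottom>\<^bsub>L1\<^esub> \<longrightarrow>
            zero_divisor_graph L =
              graph_union (zero_divisor_graph L1)
                (graph_join (null_graph ((carrier L1 - {\<bottom>\<^bsub>L1\<^esub>}) - {x \<in> carrier L1. b \<sqsubseteq>\<^bsub>L1\<^esub> x}))
                            (null_graph (carrier L2))))"
proof -
  interpret adjunct_pair L1 L2 a b
    using assms by (intro adjunct_pair.intro adjunct_pair_axioms.intro)
  show ?thesis
  proof (cases "a = \<bottom>\<^bsub>L1\<^esub>")
    case True
    \<comment> \<open>Zero is never a vertex, so (a) and (b) hold vacuously and only (c)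
      remains.\<close>
    then have "a \<notin> vertices (zero_divisor_graph L1)"
      by (simp add: vertices_zero_divisor_graph zd_vertices_def)
    with True show ?thesis
      using cross_nonempty_if_not_covers[OF True \<open>\<not> covers L1 b a\<close>]
      unfolding \<open>L = adjunct L1 a b L2\<close> zero_divisor_graph_adjunct cross_eq_zero_a[OF True]
      by auto
  next
    case False
    then show ?thesis
      using cross_nonempty_iff[OF False]
      unfolding \<open>L = adjunct L1 a b L2\<close> zero_divisor_graph_adjunct
        cross_eq_neighbours[OF False, symmetric]
      by auto
  qed
qed

end
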